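(* Let $m,n\ge 2$. An $m$th order $n$-dimensional real lower triangular sub-symmetric tensor has $\binom{n+m-1}{m}=\frac{(n+m-1)!}{m!(n-1)!}$ independent entries; that is, the real vector space $LS_{m,n}$ of all such tensors has dimension $\binom{n+m-1}{m}$.
   Context: An $m$th order $n$-dimensional real cubic tensor $\mathcal{T}=(t_{i_1\dots i_m})$ has entries $t_{i_1\dots i_m}\in\mathbb{R}$ for $i_1,\dots,i_m=1,\dots,n$. It is lower triangular if $t_{i_1\dots i_m}=0$ whenever there is $j\in\{2,\dots,m\}$ with $i_j>i_1$. A lower triangular tensor is called a lower triangular sub-symmetric tensor if $t_{i_1\dots i_m}$ is invariant under every permutation of the indices $i_2,\dots,i_m$. $LS_{m,n}$ denotes the set of all $m$th order $n$-dimensional real lower triangular sub-symmetric tensors, a linear subspace of the space of all real cubic tensors. The number of independent entries of a tensor in this class means the number of free real parameters needed to specify it, i.e. the dimension of $LS_{m,n}$ over $\mathbb{R}$. *)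

theory Defs
  imports
    Complex_Main
    "HOL-Library.Function_Algebras"
    "HOL-Library.FuncSet"
    "HOL-Combinatorics.Permutations"
begin

text \<open>The pointwise real vector space structure on functions, extending the pointwise
  additive structure of \<^theory>\<open>HOL-Library.Function_Algebras\<close>.\<close>

instantiation "fun" :: (type, scaleR) scaleR
begin

definition scaleR_fun :: "real \<Rightarrow> ('a \<Rightarrow> 'b) \<Rightarrow> 'a \<Rightarrow> 'b"
  where "scaleR_fun c f = (\<lambda>x. c *\<^sub>R f x)"

instance ..

end

lemma scaleR_fun_apply [simp]: "(c *\<^sub>R f) x = c *\<^sub>R f x"
  by (simp add: scaleR_fun_def)

instance "fun" :: (type, real_vector) real_vector
  by standard (simp_all add: fun_eq_iff scaleR_add_right scaleR_add_left)

text \<open>A multi-index \<open>(i\<^sub>1, \<dots>, i\<^sub>m)\<close> with entries in \<open>{1..n}\<close> is an extensional function on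
  \<open>{1..m}\<close>; \<open>i j\<close> is the entry in position \<open>j\<close>.\<close>

definition multi_indices :: "nat \<Rightarrow> nat \<Rightarrow> (nat \<Rightarrow> nat) set"
  where "multi_indices m n = {1..m} \<rightarrow>\<^sub>E {1..n}"

type_synonym tensor = "(nat \<Rightarrow> nat) \<Rightarrow> real"

text \<open>A tensor is determined by its entries at the multi-indices; the value 0 elsewhere makes its
  representation as a total function unique.\<close>

definition cubic_tensors :: "nat \<Rightarrow> nat \<Rightarrow> tensor set"
  where "cubic_tensors m n = {T. \<forall>i. i \<notin> multi_indices m n \<longrightarrow> T i = 0}"

definition lower_triangular :: "nat \<Rightarrow> nat \<Rightarrow> tensor \<Rightarrow> bool"
  where "lower_triangular m n T \<longleftrightarrow>
    (\<forall>i \<in> multi_indices m n. (\<exists>j \<in> {2..m}. i j > i 1) \<longrightarrow> T i = 0)"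

definition sub_symmetric :: "nat \<Rightarrow> nat \<Rightarrow> tensor \<Rightarrow> bool"
  where "sub_symmetric m n T \<longleftrightarrow>
    (\<forall>i \<in> multi_indices m n. \<forall>\<sigma>. \<sigma> permutes {2..m} \<longrightarrow> T (i \<circ> \<sigma>) = T i)"

definition LS :: "nat \<Rightarrow> nat \<Rightarrow> tensor set"
  where "LS m n = {T \<in> cubic_tensors m n. lower_triangular m n T \<and> sub_symmetric m n T}"

end

theory Submission
  imports Defs
begin

text \<open>Call a multi-index \<open>i\<close> dominated if \<open>i\<^sub>1\<close> is its largest entry. A tensor in \<open>LS m n\<close> vanishes
  at the other multi-indices, and two dominated multi-indices differ by a permutation of the
  positions \<open>2, \<dots>, m\<close> iff they have the same multiset of entries, since the maximum of that
  multiset is the first entry. So \<open>LS m n\<close> consists of the functions on the dominated multi-indices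
  that factor through the multiset of entries, and its dimension is the number of multisets of
  size \<open>m\<close> over \<open>{1..n}\<close>.\<close>

lemma dim_functions_constant_on_fibres:
  fixes X :: "'a set" and g :: "'a \<Rightarrow> 'b"
  assumes "finite (g ` X)"
  shows "dim {f :: 'a \<Rightarrow> real. (\<forall>x. x \<notin> X \<longrightarrow> f x = 0) \<and>
    (\<forall>x\<in>X. \<forall>y\<in>X. g x = g y \<longrightarrow> f x = f y)} = card (g ` X)" (is "dim ?V = _")
proof -
  define e :: "'b \<Rightarrow> 'a \<Rightarrow> real" where "e y = (\<lambda>x. of_bool (x \<in> X \<and> g x = y))" for y
  have sum_apply: "(\<Sum>y\<in>Y. h y) x = (\<Sum>y\<in>Y. h y x)" for h :: "'b \<Rightarrow> 'a \<Rightarrow> real" and Y x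
    by (induction Y rule: infinite_finite_induct) auto
  \<comment> \<open>A point of \<open>X\<close> lies in exactly one fibre, so a single summand
    survives. Independence and spanning both follow from this evaluation.\<close>
  have sum_e: "(\<Sum>y\<in>g ` X. c y *\<^sub>R e y) x = (if x \<in> X then c (g x) else 0)" for c x
  proof (cases "x \<in> X")
    case True
    then have "(\<Sum>y\<in>g ` X. c y *\<^sub>R e y) x = (\<Sum>y\<in>g ` X. if y = g x then c y else 0)"
      by (auto simp: sum_apply e_def intro!: sum.cong)
    then show ?thesis
      using True assms by simp
  qed (simp add: sum_apply e_def)
  have inj: "inj_on e (g ` X)"
  proof (rule inj_onI)
    fix y z assume "y \<in> g ` X" "z \<in> g ` X" "e y = e z"
    then obtain x where x: "x \<in> X" "g x = y" by auto
    have "e y x = e z x" using \<open>e y = e z\<close> by simp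
    then show "y = z" using x by (auto simp: e_def split: if_splits)
  qed
  have indep: "independent (e ` g ` X)"
  proof (rule independent_if_scalars_zero)
    show "finite (e ` g ` X)" using assms by simp
    fix c v assume sum0: "(\<Sum>v\<in>e ` g ` X. c v *\<^sub>R v) = 0" and "v \<in> e ` g ` X"
    then obtain x where x: "x \<in> X" "v = e (g x)" by auto
    have "(\<Sum>y\<in>g ` X. c (e y) *\<^sub>R e y) = 0"
      using sum0 by (simp add: sum.reindex[OF inj])
    then have "(\<Sum>y\<in>g ` X. c (e y) *\<^sub>R e y) x = 0" by simp
    then show "c v = 0" using x by (simp add: sum_e[of "\<lambda>y. c (e y)"])
  qed
  have "?V \<subseteq> span (e ` g ` X)"
  proof
    fix f assume f: "f \<in> ?V"
    \<comment> \<open>The chosen point of the fibre is immaterial, as \<open>f\<close> is constant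
      on it.\<close>
    define c where "c y = f (SOME x. x \<in> X \<and> g x = y)" for y
    have c: "c (g x) = f x" if "x \<in> X" for x
      using someI[of "\<lambda>z. z \<in> X \<and> g z = g x" x] that f unfolding c_def by blast
    have "f x = 0" if "x \<notin> X" for x
      using f that by blast
    with c have "f = (\<Sum>y\<in>g ` X. c y *\<^sub>R e y)"
      by (simp add: fun_eq_iff sum_e)
    also have "\<dots> \<in> span (e ` g ` X)"
      by (intro span_sum span_scale span_base) auto
    finally show "f \<in> span (e ` g ` X)" .
  qed
  moreover have "e ` g ` X \<subseteq> ?V" by (auto simp: e_def)
  ultimately have "card (e ` g ` X) = dim ?V"
    using indep by (intro basis_card_eq_dim)
  then show ?thesis using card_image[OF inj] by simp
qed

definition dominated_indices :: "nat \<Rightarrow> nat \<Rightarrow> (nat \<Rightarrow> nat) set"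
  where "dominated_indices m n = {i \<in> multi_indices m n. \<forall>j\<in>{2..m}. i j \<le> i 1}"

definition entries :: "nat \<Rightarrow> (nat \<Rightarrow> nat) \<Rightarrow> nat multiset"
  where "entries m i = image_mset i (mset_set {1..m})"

lemma entries_permute:
  assumes "\<sigma> permutes {2..m}"
  shows "entries m (i \<circ> \<sigma>) = entries m i"
proof -
  have "\<sigma> permutes {1..m}"
    using assms by (rule permutes_subset) auto
  then have "image_mset \<sigma> (mset_set {1..m}) = mset_set {1..m}"
    by (simp add: image_mset_mset_set permutes_image permutes_inj_on)
  then show ?thesis
    by (simp add: entries_def flip: multiset.map_comp)
qed

lemma multi_indices_permute:
  assumes "i \<in> multi_indices m n" "\<sigma> permutes {2..m}"
  shows "i \<circ> \<sigma> \<in> multi_indices m n"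
proof -
  have "\<sigma> permutes {1..m}"
    using assms(2) by (rule permutes_subset) auto
  then show ?thesis
    \<comment> \<open>Outside \<open>{1..m}\<close> the permutation is the identity, so the
      composite keeps the value \<open>undefined\<close> that extensionality demands there.\<close>
    using assms(1) permutes_in_image[of \<sigma> "{1..m}"]
    by (auto simp: multi_indices_def PiE_iff extensional_def permutes_not_in)
qed

lemma dominated_indices_permute:
  assumes "i \<in> dominated_indices m n" "\<sigma> permutes {2..m}"
  shows "i \<circ> \<sigma> \<in> dominated_indices m n"
proof -
  have "\<sigma> 1 = 1"
    using assms(2) by (rule permutes_not_in) simp
  then show ?thesis
    using assms permutes_in_image[OF assms(2)] multi_indices_permute
    by (auto simp: dominated_indices_def)
qed

text \<open>Recovers the first entry from the multiset alone; \<open>m \<ge> 1\<close> makes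
  position 1 contribute to that multiset.\<close>

lemma first_eq_Max_entries:
  assumes "i \<in> dominated_indices m n" "m \<ge> 1"
  shows "i 1 = Max (set_mset (entries m i))"
proof (rule Max_eqI[symmetric])
  fix k assume "k \<in> set_mset (entries m i)"
  then obtain j where "j \<in> {1..m}" "k = i j"
    by (auto simp: entries_def)
  then show "k \<le> i 1"
    using assms by (cases "j = 1") (auto simp: dominated_indices_def)
qed (use assms in \<open>auto simp: entries_def\<close>)

text \<open>The first entries agree, both being the maximum of the common multiset. Cancelling them
  leaves equal multisets over the positions \<open>{2..m}\<close>, which some permutation of these
  positions matches up.\<close>

lemma dominated_indices_eq_entries:
  assumes i: "i \<in> dominated_indices m n" and k: "k \<in> dominated_indices m n"
    and "m \<ge> 1" and eq: "entries m i = entries m k"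
  obtains \<sigma> where "\<sigma> permutes {2..m}" "i = k \<circ> \<sigma>"
proof -
  have first: "i 1 = k 1"
    using first_eq_Max_entries[OF i] first_eq_Max_entries[OF k] assms by simp
  have "{1..m} = insert 1 {2..m}"
    using \<open>m \<ge> 1\<close> by auto
  then have "image_mset i (mset_set {2..m}) = image_mset k (mset_set {2..m})"
    using eq first by (simp add: entries_def)
  then obtain \<sigma> where \<sigma>: "\<sigma> permutes {2..m}" "\<forall>j\<in>{2..m}. i j = k (\<sigma> j)"
    using image_mset_eq_implies_permutes[of "{2..m}"] by blast
  \<comment> \<open>Off \<open>{2..m}\<close> the permutation is the identity, and \<open>i\<close>
    and \<open>k\<close> agree there: at 1 by \<open>first\<close>, elsewhere because both are
    \<open>undefined\<close>.\<close>
  have "i j = k (\<sigma> j)" for j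
  proof (cases "j \<in> {2..m}")
    case False
    then have "\<sigma> j = j" using \<sigma>(1) by (simp add: permutes_not_in)
    moreover have "i j = k j"
    proof (cases "j = 1")
      case False
      then have "j \<notin> {1..m}" using \<open>j \<notin> {2..m}\<close> by auto
      then show ?thesis
        using i k by (simp add: dominated_indices_def multi_indices_def PiE_iff extensional_def)
    qed (use first in simp)
    ultimately show ?thesis by simp
  qed (use \<sigma> in blast)
  then have "i = k \<circ> \<sigma>" by auto
  then show ?thesis using that \<sigma>(1) by blast
qed

lemma entries_image_dominated_indices:
  assumes "m \<ge> 1"
  shows "entries m ` dominated_indices m n = multisets_of_size {1..n} m"
proof
  show "entries m ` dominated_indices m n \<subseteq> multisets_of_size {1..n} m"
    by (auto simp: entries_def dominated_indices_def multi_indices_def multisets_of_size_def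
        PiE_iff Ball_def)
  show "multisets_of_size {1..n} m \<subseteq> entries m ` dominated_indices m n"
  proof
    fix A assume A: "A \<in> multisets_of_size {1..n} m"
    \<comment> \<open>Listing \<open>A\<close> in decreasing order puts its maximum first, which
      makes the multi-index dominated. Lists count from 0 and positions from 1, hence the shift
      \<open>j - 1\<close>.\<close>
    define xs where "xs = rev (sorted_list_of_multiset A)"
    define i where "i j = (if j \<in> {1..m} then xs ! (j - 1) else undefined)" for j
    have mset_xs: "mset xs = A" by (simp add: xs_def)
    have len: "length xs = m" and set_xs: "set xs \<subseteq> {1..n}"
      using A unfolding mset_xs[symmetric] by (simp_all add: multisets_of_size_def)
    have "sorted_wrt (\<ge>) xs"
      by (simp add: xs_def sorted_wrt_rev)
    then have mono: "xs ! q \<le> xs ! p" if "p \<le> q" "q < m" for p q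
      using that len by (cases "p = q") (auto simp: sorted_wrt_iff_nth_less)
    have "i j \<in> {1..n}" if "j \<in> {1..m}" for j
    proof -
      have "i j \<in> set xs" using that len by (auto simp: i_def)
      then show ?thesis using set_xs by blast
    qed
    then have "i \<in> dominated_indices m n"
      using mono[of 0] assms
      by (auto simp: dominated_indices_def multi_indices_def i_def)
    moreover have "map i [1..<Suc m] = xs"
      using len by (auto simp: i_def intro!: nth_equalityI simp del: upt_Suc)
    then have "entries m i = A"
      unfolding mset_xs[symmetric] entries_def
      by (metis mset_map mset_upt atLeastLessThanSuc_atLeastAtMost)
    ultimately show "A \<in> entries m ` dominated_indices m n" by blast
  qed
qed

text \<open>Brings \<open>LS m n\<close> into the form required by
  \<open>dim_functions_constant_on_fibres\<close>, with \<open>entries m\<close> as the map whose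
  fibres count.\<close>

lemma LS_eq_constant_on_entries:
  assumes "m \<ge> 1"
  shows "LS m n = {T. (\<forall>i. i \<notin> dominated_indices m n \<longrightarrow> T i = 0) \<and>
    (\<forall>i\<in>dominated_indices m n. \<forall>k\<in>dominated_indices m n.
      entries m i = entries m k \<longrightarrow> T i = T k)}" (is "_ = ?V")
proof
  show "LS m n \<subseteq> ?V"
  proof
    fix T assume T: "T \<in> LS m n"
    have "T i = 0" if "i \<notin> dominated_indices m n" for i
      using T that unfolding LS_def cubic_tensors_def lower_triangular_def dominated_indices_def
      by (cases "i \<in> multi_indices m n") (auto simp: not_le)
    moreover have "T i = T k" if ik: "i \<in> dominated_indices m n" "k \<in> dominated_indices m n"
        "entries m i = entries m k" for i k
    proof -
      obtain \<sigma> where "\<sigma> permutes {2..m}" "i = k \<circ> \<sigma>"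
        using dominated_indices_eq_entries[OF ik(1,2) \<open>m \<ge> 1\<close> ik(3)] by blast
      then show ?thesis
        using T ik by (auto simp: LS_def sub_symmetric_def dominated_indices_def)
    qed
    ultimately show "T \<in> ?V" by blast
  qed
  show "?V \<subseteq> LS m n"
  proof
    fix T assume T: "T \<in> ?V"
    have "T (i \<circ> \<sigma>) = T i" if \<sigma>: "\<sigma> permutes {2..m}" for i \<sigma>
    proof (cases "i \<in> dominated_indices m n")
      case True
      then show ?thesis
        using T dominated_indices_permute[OF True \<sigma>] entries_permute[OF \<sigma>] by blast
    next
      case False
      \<comment> \<open>Permuting back by \<open>inv \<sigma>\<close> shows that
        \<open>i \<circ> \<sigma>\<close> cannot be dominated when \<open>i\<close> is not, so
        \<open>T\<close> vanishes at both.\<close>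
      have "(i \<circ> \<sigma>) \<circ> inv \<sigma> = i"
        using permutes_inv_o(1)[OF \<sigma>] by (simp add: comp_assoc)
      then have "i \<circ> \<sigma> \<notin> dominated_indices m n"
        using False dominated_indices_permute[OF _ permutes_inv[OF \<sigma>], of "i \<circ> \<sigma>"] by auto
      then show ?thesis using T False by simp
    qed
    then have "sub_symmetric m n T"
      by (simp add: sub_symmetric_def)
    moreover have zero: "T i = 0" if "i \<notin> dominated_indices m n" for i
      using T that by blast
    have "T \<in> cubic_tensors m n"
      by (simp add: cubic_tensors_def zero dominated_indices_def)
    moreover have "lower_triangular m n T"
      unfolding lower_triangular_def
      by (force intro!: zero simp: dominated_indices_def)
    ultimately show "T \<in> LS m n"
      by (simp add: LS_def)
  qed
qed

lemma subspace_LS: "subspace (LS m n)"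
  by (auto simp: subspace_def LS_def cubic_tensors_def lower_triangular_def sub_symmetric_def)

theorem proposition2p2:
  fixes m n :: nat
  assumes "m \<ge> 2" and "n \<ge> 2"
  shows "subspace (LS m n) \<and>
    dim (LS m n) = (n + m - 1) choose m \<and>
    real ((n + m - 1) choose m) = fact (n + m - 1) / (fact m * fact (n - 1))"
proof (intro conjI)
  have "m \<ge> 1" using assms by simp
  note image = entries_image_dominated_indices[OF this, of n]
  have "finite (entries m ` dominated_indices m n)"
    unfolding dominated_indices_def multi_indices_def
    by (intro finite_imageI finite_subset[OF _ finite_PiE[of "{1..m}" "\<lambda>_. {1..n}"]]) auto
  then have "dim (LS m n) = card (entries m ` dominated_indices m n)"
    unfolding LS_eq_constant_on_entries[OF \<open>m \<ge> 1\<close>] by (rule dim_functions_constant_on_fibres)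
  \<comment> \<open>Stars and bars: this counts the multisets of size \<open>m\<close> over the
    \<open>n\<close> elements of \<open>{1..n}\<close>.\<close>
  then show "dim (LS m n) = (n + m - 1) choose m"
    by (simp add: image card_multisets_of_size)
  \<comment> \<open>Turns the factor \<open>fact (n + m - 1 - m)\<close> of the factorial formula
    into \<open>fact (n - 1)\<close>.\<close>
  have "n + m - 1 - m = n - 1" by simp
  then show "real ((n + m - 1) choose m) = fact (n + m - 1) / (fact m * fact (n - 1))"
    using assms binomial_fact[of m "n + m - 1", where 'a = real] by simp
qed (rule subspace_LS)

end
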